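(* Let $X$ be a (real) reflexive Banach space and let $Y$ be a real vector space. Let $a:X\times Y\to\mathbb{R}\cup\{+\infty\}$ be a function such that for every $y\in Y$ the function $a(\cdot,y):X\to\mathbb{R}$ is proper continuous and convex on $X$ and for every $x\in X$ the function $a(x,\cdot):Y\to\mathbb{R}$ is concave on $Y$. Assume that there exists a point $\bar y\in Y$ such that $\sup_{y\in Y}\inf_{x\in X}a(x,y)=\inf_{x\in X}a(x,\bar y)$ and there exist $\tilde y\in Y$ and $\gamma>\sup_{y\in Y}\inf_{x\in X}a(x,y)$ such that the set $\{x\in X: a(x,\tilde y)\le\gamma\}$ is bounded in $X$. The following conditions are equivalent: (i) for every $\alpha\in\mathbb{R}$ with $\alpha<\inf_{x\in X}\sup_{y\in Y}a(x,y)$ there exist $y_1,y_2\in Y$, $x_1\in\operatorname{dom}(a(\cdot,y_1))$, $x_2\in\operatorname{dom}(a(\cdot,y_2))$, $\varphi_1\in\partial_{\Phi_{conv}}a(\cdot,y_1)(x_1)$ and $\varphi_2\in\partial_{\Phi_{conv}}a(\cdot,y_2)(x_2)$ such that the intersection property holds for $\varphi_1$ and $\varphi_2$ on $X$ at the level $\alpha$; (ii) $\sup_{y\in Y}\inf_{x\in X}a(x,y)=\inf_{x\in X}\sup_{y\in Y}a(x,y)$.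
   Context: $X^*$ is the topological dual of $X$, and $\Phi_{conv}$ is the class of functions $\varphi:X\to\mathbb{R}$ of the form $\varphi(x)=\langle\ell,x\rangle+c$ with $\ell\in X^*$, $c\in\mathbb{R}$. For a function $f$ on $X$: $\operatorname{dom}(f):=\{x\in X:f(x)<+\infty\}$; $f$ is proper if $\operatorname{dom}(f)\ne\emptyset$. For $\bar x\in\operatorname{dom}(f)$, the $\Phi_{conv}$-subdifferential is $\partial_{\Phi_{conv}}f(\bar x):=\{\varphi\in\Phi_{conv}:\ \varphi(x)\le f(x)\ \forall x\in X,\ \varphi(\bar x)=f(\bar x)\}$. Functions $\varphi_1,\varphi_2:X\to\mathbb{R}$ have the intersection property on $X$ at the level $\alpha\in\mathbb{R}$ if $[\varphi_1<\alpha]\cap[\varphi_2<\alpha]=\emptyset$, where $[\varphi<\alpha]:=\{x\in X:\varphi(x)<\alpha\}$. *)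

theory Defs
  imports "HOL-Analysis.Analysis"
begin

text \<open>A normed space is reflexive if the canonical embedding into its bidual is onto.\<close>

definition reflexive_space :: "'a::real_normed_vector itself \<Rightarrow> bool" where
  "reflexive_space (T :: 'a itself) \<longleftrightarrow>
     (\<forall>F :: ('a \<Rightarrow>\<^sub>L real) \<Rightarrow>\<^sub>L real. \<exists>x :: 'a. \<forall>l :: 'a \<Rightarrow>\<^sub>L real.
        blinfun_apply F l = blinfun_apply l x)"

definition eff_dom :: "('a \<Rightarrow> ereal) \<Rightarrow> 'a set" where
  "eff_dom f = {x. f x < \<infinity>}"

definition proper_fun :: "('a \<Rightarrow> ereal) \<Rightarrow> bool" where
  "proper_fun f \<longleftrightarrow> eff_dom f \<noteq> {}"

text \<open>Convexity and concavity are meant for functions that never take the value \<open>-\<infinity>\<close>,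
  so no sum below is of the form \<open>\<infinity> - \<infinity>\<close>; strict bounds on the parameter avoid \<open>0 * \<infinity>\<close>.\<close>

definition ereal_convex :: "('a::real_vector \<Rightarrow> ereal) \<Rightarrow> bool" where
  "ereal_convex f \<longleftrightarrow>
     (\<forall>u v. \<forall>t::real. 0 < t \<longrightarrow> t < 1 \<longrightarrow>
        f (t *\<^sub>R u + (1 - t) *\<^sub>R v) \<le> ereal t * f u + ereal (1 - t) * f v)"

definition ereal_concave :: "('a::real_vector \<Rightarrow> ereal) \<Rightarrow> bool" where
  "ereal_concave f \<longleftrightarrow>
     (\<forall>u v. \<forall>t::real. 0 < t \<longrightarrow> t < 1 \<longrightarrow>
        ereal t * f u + ereal (1 - t) * f v \<le> f (t *\<^sub>R u + (1 - t) *\<^sub>R v))"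

definition Phi_conv :: "('a::real_normed_vector \<Rightarrow> real) set" where
  "Phi_conv = {\<phi>. \<exists>(l :: 'a \<Rightarrow>\<^sub>L real) (c :: real). \<phi> = (\<lambda>x. blinfun_apply l x + c)}"

definition subdiff_conv ::
  "('a::real_normed_vector \<Rightarrow> ereal) \<Rightarrow> 'a \<Rightarrow> ('a \<Rightarrow> real) set" where
  "subdiff_conv f xbar =
     {\<phi> \<in> Phi_conv. (\<forall>x. ereal (\<phi> x) \<le> f x) \<and> ereal (\<phi> xbar) = f xbar}"

definition intersection_property :: "('a \<Rightarrow> real) \<Rightarrow> ('a \<Rightarrow> real) \<Rightarrow> real \<Rightarrow> bool" where
  "intersection_property \<phi>1 \<phi>2 \<alpha> \<longleftrightarrow> {x. \<phi>1 x < \<alpha>} \<inter> {x. \<phi>2 x < \<alpha>} = {}"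

end

theory Submission
  imports Defs
begin

text \<open>
  \<^emph>\<open>From (i) to the minimax equality.\<close> If two affine minorants \<open>\<phi>\<^sub>1 \<le> a(\<cdot>,y\<^sub>1)\<close> and
  \<open>\<phi>\<^sub>2 \<le> a(\<cdot>,y\<^sub>2)\<close> are never both below \<open>\<alpha>\<close>, then the image of \<open>X\<close> under \<open>(\<phi>\<^sub>1,\<phi>\<^sub>2)\<close> is a
  convex subset of the plane that misses an open quadrant. A separating line yields
  \<open>t \<in> [0,1]\<close> with \<open>t\<phi>\<^sub>1 + (1-t)\<phi>\<^sub>2 \<ge> \<alpha>\<close> on \<open>X\<close> (\<open>affine_pair_alternative\<close>). Concavity in the
  second variable turns this into \<open>a(\<cdot>,y) \<ge> \<alpha>\<close> for \<open>y = ty\<^sub>1 + (1-t)y\<^sub>2\<close>, so the lower value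
  is at least \<open>\<alpha>\<close>.

  \<^emph>\<open>From the minimax equality to (i).\<close> A constant is a subgradient at a minimiser, and a
  constant that is at least \<open>\<alpha>\<close> has the intersection property with itself. So it is enough to
  find one \<open>y\<close> for which \<open>a(\<cdot>,y)\<close> attains a minimum and this minimum is at least \<open>\<alpha>\<close>. The
  maximiser \<open>ybar\<close> has the right infimum \<open>v\<close>, which need not be attained. The point \<open>ytil\<close> has
  a bounded sublevel set, hence an attained minimum \<open>m\<close>, which may be too small. Points
  \<open>y = t ybar + (1-t) ytil\<close> with \<open>t < 1\<close> close to \<open>1\<close> have both virtues. Indeed, concavity gives
  \<open>a(\<cdot>,y) \<ge> tv + (1-t) a(\<cdot>,ytil)\<close>, so the infimum is at least \<open>tv + (1-t)m \<ge> \<alpha>\<close>, and the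
  sublevel set at height \<open>tv + (1-t)\<gamma> > v\<close> lies in the bounded set \<open>{a(\<cdot>,ytil) \<le> \<gamma>}\<close>.

  \<^emph>\<open>Existence of minimisers.\<close> In a reflexive space a chain of nonempty bounded closed convex
  sets has a common point (\<open>reflexive_chain_Inter_nonempty\<close>). Applied to sublevel sets this
  gives \<open>reflexive_attains_inf\<close>. No weak topology is used. The infimum of the support
  functions of the chain is a sublinear functional on the dual space. By Hahn-Banach it
  dominates a linear functional, which by reflexivity is evaluation at a point \<open>x\<close>. So \<open>x\<close>
  satisfies every closed half-space inequality valid on some member of the chain, and
  separation puts \<open>x\<close> in all members. Hahn-Banach (\<open>sublinear_dominates_linear\<close>) and separation
  (through \<open>mazur_orlicz\<close>) rest on one construction, \<open>sublinear_minorant_above_on_convex\<close>.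
\<close>

section \<open>Sublinear functionals and the Mazur-Orlicz theorem\<close>

text \<open>Homogeneity is required only as an inequality, which is easier to check for infima and
  implies equality (\<open>sublinear_scaleR\<close>).\<close>

definition sublinear :: "('v::real_vector \<Rightarrow> real) \<Rightarrow> bool" where
  "sublinear p \<longleftrightarrow> (\<forall>x y. p (x + y) \<le> p x + p y) \<and> (\<forall>t x. 0 \<le> t \<longrightarrow> p (t *\<^sub>R x) \<le> t * p x)"

lemma sublinearI:
  assumes "\<And>x y. p (x + y) \<le> p x + p y" "\<And>t x. 0 \<le> t \<Longrightarrow> p (t *\<^sub>R x) \<le> t * p x"
  shows "sublinear p"
  using assms by (simp add: sublinear_def)

lemma sublinear_add: "sublinear p \<Longrightarrow> p (x + y) \<le> p x + p y"
  by (simp add: sublinear_def)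

lemma sublinear_scaleR_le: "sublinear p \<Longrightarrow> 0 \<le> t \<Longrightarrow> p (t *\<^sub>R x) \<le> t * p x"
  by (simp add: sublinear_def)

lemma sublinear_0: "sublinear p \<Longrightarrow> p 0 = 0"
  using sublinear_add[of p 0 0] sublinear_scaleR_le[of p 0 0] by simp

lemma sublinear_neg: "sublinear p \<Longrightarrow> - p (- x) \<le> p x"
  using sublinear_add[of p x "- x"] sublinear_0[of p] by simp

lemma sublinear_scaleR:
  assumes "sublinear p" "0 \<le> t"
  shows "p (t *\<^sub>R x) = t * p x"
proof (cases "t = 0")
  case True
  then show ?thesis using sublinear_0[OF assms(1)] by simp
next
  case False
  then have t: "t > 0" using assms(2) by simp
  have "p ((1 / t) *\<^sub>R (t *\<^sub>R x)) \<le> (1 / t) * p (t *\<^sub>R x)"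
    using t by (intro sublinear_scaleR_le[OF assms(1)]) simp
  then have "t * p x \<le> p (t *\<^sub>R x)"
    using t by (simp add: field_simps)
  then show ?thesis
    using sublinear_scaleR_le[OF assms] by (simp add: order_antisym)
qed

lemma le_mult_cInf:
  fixes S :: "real set"
  assumes "S \<noteq> {}" "0 \<le> t" "\<And>v. v \<in> S \<Longrightarrow> u \<le> t * v"
  shows "u \<le> t * Inf S"
proof (cases "t = 0")
  case True
  then show ?thesis using assms by fastforce
next
  case False
  then have "u / t \<le> Inf S"
    using assms by (intro cInf_greatest) (auto simp: field_simps)
  then show ?thesis using False assms(2) by (simp add: field_simps)
qed

lemma le_add_cInf:
  fixes S T :: "real set"
  assumes "S \<noteq> {}" "T \<noteq> {}" "\<And>v w. v \<in> S \<Longrightarrow> w \<in> T \<Longrightarrow> u \<le> v + w"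
  shows "u \<le> Inf S + Inf T"
proof -
  have "u - v \<le> Inf T" if "v \<in> S" for v
    using assms(2) assms(3)[OF that] by (intro cInf_greatest) (auto simp: diff_le_eq add.commute)
  then have "u - Inf T \<le> v" if "v \<in> S" for v
    using that by (simp add: diff_le_eq add.commute)
  then have "u - Inf T \<le> Inf S"
    by (rule cInf_greatest[OF assms(1)])
  then show ?thesis by simp
qed

text \<open>Comparability is what saves subadditivity: two members of the chain can be replaced by
  the smaller one, to which subadditivity applies.\<close>

lemma sublinear_INF_chain:
  fixes Q :: "('v::real_vector \<Rightarrow> real) set"
  assumes ne: "Q \<noteq> {}" and sub: "\<And>q. q \<in> Q \<Longrightarrow> sublinear q"
    and chain: "\<And>q r. q \<in> Q \<Longrightarrow> r \<in> Q \<Longrightarrow> q \<le> r \<or> r \<le> q"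
    and bdd: "\<And>x. bdd_below ((\<lambda>q. q x) ` Q)"
  shows "sublinear (\<lambda>x. INF q\<in>Q. q x)"
proof (rule sublinearI)
  fix x y
  have "(INF q\<in>Q. q (x + y)) \<le> q x + r y" if qr: "q \<in> Q" "r \<in> Q" for q r
  proof -
    obtain s where s: "s \<in> Q" "s \<le> q" "s \<le> r"
      using chain qr by blast
    have "(INF q\<in>Q. q (x + y)) \<le> s (x + y)"
      by (rule cINF_lower[OF bdd s(1)])
    also have "\<dots> \<le> s x + s y"
      by (rule sublinear_add[OF sub[OF s(1)]])
    also have "\<dots> \<le> q x + r y"
      using s by (intro add_mono) (auto simp: le_fun_def)
    finally show ?thesis .
  qed
  then show "(INF q\<in>Q. q (x + y)) \<le> (INF q\<in>Q. q x) + (INF q\<in>Q. q y)"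
    using ne by (intro le_add_cInf) auto
next
  fix t :: real and x
  assume t: "0 \<le> t"
  have "(INF q\<in>Q. q (t *\<^sub>R x)) \<le> t * q x" if "q \<in> Q" for q
    using cINF_lower[OF bdd that] sublinear_scaleR_le[OF sub[OF that] t] by (rule order_trans)
  then show "(INF q\<in>Q. q (t *\<^sub>R x)) \<le> t * (INF q\<in>Q. q x)"
    using ne t by (intro le_mult_cInf) auto
qed

text \<open>The functional \<open>q(z) = inf (p(z + \<lambda>c) - \<lambda>\<beta>)\<close> over \<open>\<lambda> \<ge> 0\<close> and \<open>c \<in> C\<close> is the largest
  sublinear functional below \<open>p\<close> with the stated bound on \<open>-C\<close>; the bound forces every linear
  \<open>F \<le> q\<close> to satisfy \<open>F \<ge> \<beta>\<close> on \<open>C\<close>. The infimum is finite because \<open>p \<ge> \<beta>\<close> on \<open>C\<close>, and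
  convexity of \<open>C\<close> makes \<open>q\<close> subadditive.\<close>

lemma sublinear_minorant_above_on_convex:
  fixes p :: "'v::real_vector \<Rightarrow> real"
  assumes p: "sublinear p" and C: "convex C" "C \<noteq> {}" and \<beta>: "\<And>c. c \<in> C \<Longrightarrow> \<beta> \<le> p c"
  obtains q where "sublinear q" "q \<le> p" "\<And>c. c \<in> C \<Longrightarrow> q (- c) \<le> - \<beta>"
proof -
  define S where "S z = {p (z + l *\<^sub>R c) - l * \<beta> | l c. 0 \<le> l \<and> c \<in> C}" for z
  define q where "q z = Inf (S z)" for z
  have ne: "S z \<noteq> {}" for z
    using C(2) by (auto simp: S_def intro: exI[of _ 0])
  have low: "- p (- z) \<le> v" if v: "v \<in> S z" for z v
  proof -
    obtain l c where lc: "0 \<le> l" "c \<in> C" "v = p (z + l *\<^sub>R c) - l * \<beta>"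
      using v by (auto simp: S_def)
    have "l * \<beta> \<le> l * p c"
      using lc \<beta> by (intro mult_left_mono) auto
    also have "\<dots> = p (- z + (z + l *\<^sub>R c))"
      using sublinear_scaleR[OF p lc(1)] by simp
    also have "\<dots> \<le> p (- z) + p (z + l *\<^sub>R c)"
      by (rule sublinear_add[OF p])
    finally show ?thesis using lc by simp
  qed
  have upper: "q z \<le> p (z + l *\<^sub>R c) - l * \<beta>" if "0 \<le> l" "c \<in> C" for z l c
    unfolding q_def using that low[of _ z]
    by (intro cInf_lower bdd_belowI) (auto simp: S_def)
  show thesis
  proof
    show "sublinear q"
    proof (rule sublinearI)
      fix x y
      have "q (x + y) \<le> v + w" if vw: "v \<in> S x" "w \<in> S y" for v w
      proof -
        obtain l c where lc: "0 \<le> l" "c \<in> C" "v = p (x + l *\<^sub>R c) - l * \<beta>"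
          using vw by (auto simp: S_def)
        obtain k d where kd: "0 \<le> k" "d \<in> C" "w = p (y + k *\<^sub>R d) - k * \<beta>"
          using vw by (auto simp: S_def)
        obtain e where e: "e \<in> C" "(l + k) *\<^sub>R e = l *\<^sub>R c + k *\<^sub>R d"
        proof (cases "l + k = 0")
          case True
          then have "l = 0" "k = 0" using lc(1) kd(1) by auto
          then show thesis using that[of c] lc by simp
        next
          case False
          then have pos: "l + k > 0" using lc(1) kd(1) by simp
          define e where "e = (l / (l + k)) *\<^sub>R c + (k / (l + k)) *\<^sub>R d"
          have "e \<in> C"
            unfolding e_def using C(1) lc kd pos
            by (intro convexD) (auto simp: add_divide_distrib[symmetric])
          moreover have "(l + k) *\<^sub>R e = l *\<^sub>R c + k *\<^sub>R d"
            using pos by (simp add: e_def scaleR_add_right)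
          ultimately show thesis by (rule that)
        qed
        have "q (x + y) \<le> p (x + y + (l + k) *\<^sub>R e) - (l + k) * \<beta>"
          using lc kd e by (intro upper) auto
        also have "x + y + (l + k) *\<^sub>R e = (x + l *\<^sub>R c) + (y + k *\<^sub>R d)"
          by (simp add: e)
        also have "p ((x + l *\<^sub>R c) + (y + k *\<^sub>R d)) - (l + k) * \<beta> \<le> v + w"
          using sublinear_add[OF p, of "x + l *\<^sub>R c" "y + k *\<^sub>R d"] lc kd
          by (simp add: algebra_simps)
        finally show ?thesis .
      qed
      then show "q (x + y) \<le> q x + q y"
        using ne unfolding q_def[of x] q_def[of y] by (intro le_add_cInf) auto
    next
      fix t :: real and x
      assume t: "0 \<le> t"
      have "q (t *\<^sub>R x) \<le> t * v" if v: "v \<in> S x" for v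
      proof -
        obtain l c where lc: "0 \<le> l" "c \<in> C" "v = p (x + l *\<^sub>R c) - l * \<beta>"
          using v by (auto simp: S_def)
        have "q (t *\<^sub>R x) \<le> p (t *\<^sub>R x + (t * l) *\<^sub>R c) - (t * l) * \<beta>"
          using lc t by (intro upper) auto
        also have "t *\<^sub>R x + (t * l) *\<^sub>R c = t *\<^sub>R (x + l *\<^sub>R c)"
          by (simp add: scaleR_add_right)
        also have "p (t *\<^sub>R (x + l *\<^sub>R c)) - (t * l) * \<beta> \<le> t * v"
          using sublinear_scaleR_le[OF p t, of "x + l *\<^sub>R c"] lc(3)
          by (simp add: right_diff_distrib mult.assoc)
        finally show ?thesis .
      qed
      then show "q (t *\<^sub>R x) \<le> t * q x"
        using ne t unfolding q_def[of x] by (intro le_mult_cInf) auto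
    qed
    show "q \<le> p"
      using upper[of 0] C(2) by (auto simp: le_fun_def)
    show "q (- c) \<le> - \<beta>" if "c \<in> C" for c
      using upper[of 1 c "- c"] that sublinear_0[OF p] by simp
  qed
qed

text \<open>This is the Hahn-Banach theorem. By Zorn's lemma there is a minimal sublinear functional
  below \<open>p\<close>. If \<open>q\<close> is minimal, the previous construction with \<open>C = {x}\<close> and \<open>\<beta> = q x\<close> cannot
  lower it, so \<open>q(-x) \<le> -q(x)\<close>; an odd sublinear functional is linear.\<close>

lemma sublinear_dominates_linear:
  fixes p :: "'v::real_vector \<Rightarrow> real"
  assumes p: "sublinear p"
  obtains F where "linear F" "\<And>x. F x \<le> p x"
proof -
  define A where "A = {q. sublinear q \<and> q \<le> p}"
  let ?P = "\<lambda>q r :: 'v \<Rightarrow> real. r \<le> q"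
  have po: "partial_order_on A (relation_of ?P A)"
    by (rule partial_order_on_relation_ofI) auto
  have "\<exists>u\<in>A. \<forall>q\<in>Q. ?P q u" if "Q \<in> Chains (relation_of ?P A)" for Q
  proof (cases "Q = {}")
    case True
    then show ?thesis using p by (auto simp: A_def)
  next
    case False
    have QA: "q \<in> A" if "q \<in> Q" for q
      using \<open>Q \<in> Chains _\<close> that by (auto simp: Chains_def relation_of_def)
    have chain: "q \<le> r \<or> r \<le> q" if "q \<in> Q" "r \<in> Q" for q r
      using \<open>Q \<in> Chains _\<close> that by (auto simp: Chains_def relation_of_def)
    have "- p (- x) \<le> q x" if "q \<in> Q" for q x
    proof -
      have "q (- x) \<le> p (- x)" "- q (- x) \<le> q x"
        using QA[OF that] sublinear_neg[of q x] by (auto simp: A_def le_fun_def)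
      then show ?thesis by linarith
    qed
    then have bdd: "bdd_below ((\<lambda>q. q x) ` Q)" for x
      by (intro bdd_belowI2[of _ "- p (- x)"]) auto
    let ?u = "\<lambda>x. INF q\<in>Q. q x"
    have u: "?u \<le> q" if "q \<in> Q" for q
      using cINF_lower[OF bdd that] by (simp add: le_fun_def)
    have "sublinear ?u"
      using False QA chain bdd by (intro sublinear_INF_chain) (auto simp: A_def)
    moreover have "?u \<le> p"
    proof -
      obtain q where q: "q \<in> Q" using False by blast
      from u[OF q] have "?u \<le> q" .
      also have "q \<le> p" using QA[OF q] by (simp add: A_def)
      finally show ?thesis .
    qed
    ultimately show ?thesis using u by (auto simp: A_def)
  qed
  from predicate_Zorn[OF po this] obtain F
    where FA: "F \<in> A" and minA: "\<And>q. q \<in> A \<Longrightarrow> q \<le> F \<Longrightarrow> q = F"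
    by auto
  have F: "sublinear F" "F \<le> p" using FA by (simp_all add: A_def)
  have min: "q = F" if "sublinear q" "q \<le> F" for q
  proof (rule minA[OF _ that(2)])
    have "q \<le> p" using that(2) F(2) by (rule order_trans)
    then show "q \<in> A" using that(1) by (simp add: A_def)
  qed
  have odd: "F (- x) = - F x" for x
  proof -
    obtain q where q: "sublinear q" "q \<le> F" "\<And>c. c \<in> {x} \<Longrightarrow> q (- c) \<le> - F x"
      by (rule sublinear_minorant_above_on_convex[OF F(1), of "{x}" "F x"]) auto
    have "F (- x) \<le> - F x"
      using min[OF q(1,2)] q(3)[of x] by simp
    moreover have "- F x \<le> F (- x)"
      using sublinear_neg[OF F(1), of "- x"] by simp
    ultimately show ?thesis by simp
  qed
  have "linear F"
  proof (rule linearI)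
    fix x y
    have "F (- x + - y) \<le> F (- x) + F (- y)"
      by (rule sublinear_add[OF F(1)])
    also have "- x + - y = - (x + y)" by simp
    finally have "F x + F y \<le> F (x + y)" unfolding odd by linarith
    then show "F (x + y) = F x + F y"
      using sublinear_add[OF F(1), of x y] by simp
  next
    fix t x
    show "F (t *\<^sub>R x) = t *\<^sub>R F x"
    proof (cases "0 \<le> t")
      case True
      then show ?thesis using sublinear_scaleR[OF F(1)] by simp
    next
      case False
      then have "F ((- t) *\<^sub>R x) = (- t) * F x"
        by (intro sublinear_scaleR[OF F(1)]) simp
      then show ?thesis by (simp add: odd)
    qed
  qed
  then show thesis
    using F(2) by (intro that) (auto simp: le_fun_def)
qed

theorem mazur_orlicz:
  fixes p :: "'v::real_vector \<Rightarrow> real"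
  assumes "sublinear p" "convex C" "C \<noteq> {}" "\<And>c. c \<in> C \<Longrightarrow> \<beta> \<le> p c"
  obtains F where "linear F" "\<And>x. F x \<le> p x" "\<And>c. c \<in> C \<Longrightarrow> \<beta> \<le> F c"
proof -
  obtain q where q: "sublinear q" "q \<le> p" "\<And>c. c \<in> C \<Longrightarrow> q (- c) \<le> - \<beta>"
    using sublinear_minorant_above_on_convex[OF assms] by blast
  obtain F where F: "linear F" "\<And>x. F x \<le> q x"
    using sublinear_dominates_linear[OF q(1)] by blast
  show thesis
  proof
    show "F x \<le> p x" for x
      using F(2)[of x] q(2) by (auto simp: le_fun_def intro: order_trans)
    show "\<beta> \<le> F c" if "c \<in> C" for c
      using F(2)[of "- c"] q(3)[OF that] linear_neg[OF F(1), of c] by linarith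
  qed (rule F(1))
qed

section \<open>Separation in normed spaces\<close>

lemma linear_bounded_imp_blinfun:
  fixes F :: "'v::real_normed_vector \<Rightarrow> real"
  assumes F: "linear F" and le: "\<And>x. F x \<le> K * norm x"
  obtains l :: "'v \<Rightarrow>\<^sub>L real" where "blinfun_apply l = F"
proof -
  have "\<bar>F x\<bar> \<le> norm x * K" for x
    using le[of x] le[of "- x"] linear_neg[OF F, of x] by (simp add: abs_le_iff mult.commute)
  then have "bounded_linear F"
    using F by (intro bounded_linear_intro[where K = K])
      (auto simp: linear_add linear_scale)
  then show thesis
    by (intro that[of "Blinfun F"]) (simp add: bounded_linear_Blinfun_apply)
qed

text \<open>Apply the Mazur-Orlicz theorem to the norm and the translate \<open>C - x\<close>, on which the norm
  is at least the distance from \<open>x\<close> to \<open>C\<close>.\<close>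

lemma separate_point_closed_convex:
  fixes C :: "'v::real_normed_vector set"
  assumes C: "convex C" "closed C" "C \<noteq> {}" and x: "x \<notin> C"
  obtains l :: "'v \<Rightarrow>\<^sub>L real" and d where "0 < d" "\<And>c. c \<in> C \<Longrightarrow> l x + d \<le> l c"
proof -
  define d where "d = infdist x C"
  have d: "0 < d"
    using infdist_pos_not_in_closed[OF C(2,3) x] by (simp add: d_def)
  have sub: "sublinear (norm :: 'v \<Rightarrow> real)"
    by (rule sublinearI) (auto simp: norm_triangle_ineq)
  have conv: "convex ((\<lambda>c. c - x) ` C)"
    using C(1) by (rule convex_translation_subtract)
  have ne: "(\<lambda>c. c - x) ` C \<noteq> {}"
    using C(3) by simp
  have ge: "d \<le> norm z" if "z \<in> (\<lambda>c. c - x) ` C" for z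
    using that infdist_le[of _ C x] by (auto simp: d_def dist_norm norm_minus_commute)
  show thesis
  proof (rule mazur_orlicz[OF sub conv ne ge])
    fix F :: "'v \<Rightarrow> real"
    assume F: "linear F" "\<And>z. F z \<le> norm z" "\<And>z. z \<in> (\<lambda>c. c - x) ` C \<Longrightarrow> d \<le> F z"
    obtain l :: "'v \<Rightarrow>\<^sub>L real" where l: "blinfun_apply l = F"
      by (rule linear_bounded_imp_blinfun[OF F(1), of 1]) (use F(2) in auto)
    show thesis
    proof (rule that[OF d])
      fix c assume "c \<in> C"
      then have "d \<le> F (c - x)" by (intro F(3)) auto
      then show "l x + d \<le> l c" by (simp add: l linear_diff[OF F(1)])
    qed
  qed
qed

section \<open>Minimisers in reflexive spaces\<close>

lemma bdd_above_blinfun_image: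
  fixes l :: "'v::real_normed_vector \<Rightarrow>\<^sub>L real"
  assumes "bounded C"
  shows "bdd_above (blinfun_apply l ` C)"
  using bounded_linear_image[OF assms blinfun.bounded_linear_right[of l]]
  by (simp add: bounded_imp_bdd_above)

text \<open>Each support function \<open>l \<mapsto> sup\<^sub>C l\<close> is sublinear on the dual space, and so is the infimum
  \<open>p\<close> over the chain. A linear functional below \<open>p\<close> is bounded, because a single member of the
  chain is bounded; so it is an element of the bidual and reflexivity applies to it.\<close>

lemma reflexive_chain_Inter_nonempty:
  fixes \<C> :: "'v::real_normed_vector set set"
  assumes refl: "reflexive_space TYPE('v)" and ne: "\<C> \<noteq> {}"
    and mem: "\<And>C. C \<in> \<C> \<Longrightarrow> C \<noteq> {} \<and> bounded C \<and> closed C \<and> convex C"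
    and chain: "\<And>C D. C \<in> \<C> \<Longrightarrow> D \<in> \<C> \<Longrightarrow> C \<subseteq> D \<or> D \<subseteq> C"
  shows "\<Inter>\<C> \<noteq> {}"
proof -
  define s where "s C l = (SUP c\<in>C. blinfun_apply l c)" for C and l :: "'v \<Rightarrow>\<^sub>L real"
  have s_upper: "blinfun_apply l c \<le> s C l" if "C \<in> \<C>" "c \<in> C" for C c l
    unfolding s_def using that mem by (intro cSUP_upper bdd_above_blinfun_image) auto
  have s_least: "s C l \<le> u" if "C \<in> \<C>" "\<And>c. c \<in> C \<Longrightarrow> blinfun_apply l c \<le> u" for C l u
    unfolding s_def using that mem by (intro cSUP_least) auto
  have s_sub: "sublinear (s C)" if C: "C \<in> \<C>" for C
  proof (rule sublinearI)
    show "s C (l + k) \<le> s C l + s C k" for l k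
      using C by (intro s_least) (auto simp: blinfun.add_left intro!: add_mono s_upper)
    show "s C (t *\<^sub>R l) \<le> t * s C l" if "0 \<le> t" for t l
      using C that by (intro s_least) (auto simp: blinfun.scaleR_left intro!: mult_left_mono s_upper)
  qed
  have s_mono: "s C \<le> s D" if "C \<in> \<C>" "D \<in> \<C>" "C \<subseteq> D" for C D
    using that by (auto simp: le_fun_def intro!: s_least s_upper)
  obtain C0 where C0: "C0 \<in> \<C>" using ne by blast
  \<comment> \<open>Any two members of the chain meet, so the infimum over the chain stays finite.\<close>
  have "- s C0 (- l) \<le> s C l" if C: "C \<in> \<C>" for C l
  proof -
    obtain c where c: "c \<in> C" "c \<in> C0"
      using chain[OF C C0] mem[OF C] mem[OF C0] by blast
    show ?thesis
      using s_upper[OF C c(1), of l] s_upper[OF C0 c(2), of "- l"]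
      by (simp add: blinfun.minus_left)
  qed
  then have bdd: "bdd_below ((\<lambda>q. q l) ` s ` \<C>)" for l
    by (intro bdd_belowI[of _ "- s C0 (- l)"]) auto
  define p where "p = (\<lambda>l. INF q\<in>s ` \<C>. q l)"
  have "sublinear p"
    unfolding p_def
  proof (rule sublinear_INF_chain)
    show "s ` \<C> \<noteq> {}" using ne by simp
    show "sublinear q" if "q \<in> s ` \<C>" for q
      using that s_sub by auto
    show "q \<le> r \<or> r \<le> q" if qr: "q \<in> s ` \<C>" "r \<in> s ` \<C>" for q r
    proof -
      from qr obtain C D where CD: "C \<in> \<C>" "D \<in> \<C>" and "q = s C" "r = s D"
        by (elim imageE)
      then show ?thesis
        using chain[OF CD] s_mono[OF CD] s_mono[OF CD(2,1)] by simp metis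
    qed
  qed (rule bdd)
  then obtain F where F: "linear F" "\<And>l. F l \<le> p l"
    using sublinear_dominates_linear by blast
  have F_le: "F l \<le> s C l" if "C \<in> \<C>" for C l
    using F(2)[of l] cINF_lower[OF bdd imageI[OF that], of l] unfolding p_def by (rule order_trans)
  obtain B where B: "\<And>c. c \<in> C0 \<Longrightarrow> norm c \<le> B"
    using mem[OF C0] by (auto simp: bounded_iff)
  have F_bdd: "F l \<le> B * norm l" for l
  proof -
    have "blinfun_apply l c \<le> B * norm l" if "c \<in> C0" for c
    proof -
      have "blinfun_apply l c \<le> norm (blinfun_apply l c)" by simp
      also have "\<dots> \<le> norm l * norm c" by (rule norm_blinfun)
      also have "\<dots> \<le> norm l * B" using B[OF that] by (intro mult_left_mono) auto
      finally show ?thesis by (simp add: mult.commute)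
    qed
    then have "s C0 l \<le> B * norm l" by (rule s_least[OF C0])
    with F_le[OF C0] show ?thesis by (rule order_trans)
  qed
  obtain L :: "('v \<Rightarrow>\<^sub>L real) \<Rightarrow>\<^sub>L real" where L: "blinfun_apply L = F"
    by (rule linear_bounded_imp_blinfun[OF F(1) F_bdd])
  obtain x where x: "\<And>l :: 'v \<Rightarrow>\<^sub>L real. F l = blinfun_apply l x"
    using refl[unfolded reflexive_space_def, rule_format, of L] unfolding L by (elim exE) blast
  have "x \<in> C" if C: "C \<in> \<C>" for C
  proof (rule ccontr)
    assume xC: "x \<notin> C"
    have C': "convex C" "closed C" "C \<noteq> {}"
      using mem[OF C] by simp_all
    obtain l :: "'v \<Rightarrow>\<^sub>L real" and d
      where ld: "0 < d" "\<And>c. c \<in> C \<Longrightarrow> blinfun_apply l x + d \<le> blinfun_apply l c"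
      using separate_point_closed_convex[OF C' xC] by blast
    \<comment> \<open>\<open>x\<close> satisfies upper bounds valid on \<open>C\<close>, whence the sign change.\<close>
    have "s C (- l) \<le> - (blinfun_apply l x + d)"
      by (rule s_least[OF C]) (use ld(2) in \<open>simp add: blinfun.minus_left le_diff_eq algebra_simps\<close>)
    moreover have "- blinfun_apply l x \<le> s C (- l)"
      using F_le[OF C, of "- l"] x[of "- l"] by (simp add: blinfun.minus_left)
    ultimately show False using ld(1) by linarith
  qed
  then show ?thesis by blast
qed

lemma convex_sublevel_ereal_convex:
  assumes "ereal_convex f"
  shows "convex {x. f x \<le> ereal r}"
proof (rule convexI)
  fix x y and s t :: real
  assume xy: "x \<in> {x. f x \<le> ereal r}" "y \<in> {x. f x \<le> ereal r}"
    and st: "0 \<le> s" "0 \<le> t" "s + t = 1"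
  have t_eq: "t = 1 - s" using st by simp
  show "s *\<^sub>R x + t *\<^sub>R y \<in> {x. f x \<le> ereal r}"
  proof (cases "s = 0 \<or> s = 1")
    case True
    then show ?thesis using xy st by auto
  next
    case False
    then have s: "0 < s" "s < 1" using st by auto
    have "f (s *\<^sub>R x + t *\<^sub>R y) \<le> ereal s * f x + ereal t * f y"
      using assms s unfolding ereal_convex_def t_eq by blast
    also have "\<dots> \<le> ereal s * ereal r + ereal t * ereal r"
      using xy st by (intro add_mono ereal_mult_left_mono) auto
    also have "\<dots> = ereal r"
      using st by (simp add: distrib_right[symmetric])
    finally show ?thesis by simp
  qed
qed

text \<open>The sublevel sets at real heights between the infimum and \<open>\<gamma>\<close> form a chain, and their
  common points are the minimisers.\<close>

lemma reflexive_attains_inf: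
  fixes f :: "'v::real_normed_vector \<Rightarrow> ereal"
  assumes refl: "reflexive_space TYPE('v)" and cont: "continuous_on UNIV f"
    and conv: "ereal_convex f" and bdd: "bounded {x. f x \<le> ereal \<gamma>}"
    and less: "(INF x. f x) < ereal \<gamma>"
  obtains x where "f x = (INF x. f x)"
proof -
  let ?I = "{r. (INF x. f x) < ereal r \<and> r \<le> \<gamma>}"
  let ?\<C> = "(\<lambda>r. {x. f x \<le> ereal r}) ` ?I"
  have "\<Inter>?\<C> \<noteq> {}"
  proof (rule reflexive_chain_Inter_nonempty[OF refl])
    show "?\<C> \<noteq> {}" using less by auto
  next
    fix C assume "C \<in> ?\<C>"
    then obtain r where r: "(INF x. f x) < ereal r" "r \<le> \<gamma>" and C: "C = {x. f x \<le> ereal r}"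
      by auto
    obtain z where "f z < ereal r"
      using r(1) by (auto simp: INF_less_iff)
    then have "C \<noteq> {}" by (auto simp: C intro: less_imp_le)
    moreover have "bounded C"
      by (rule bounded_subset[OF bdd]) (use r in \<open>auto simp: C intro: order_trans\<close>)
    moreover have "closed C"
      unfolding C by (intro closed_Collect_le cont continuous_on_const)
    moreover have "convex C"
      unfolding C by (rule convex_sublevel_ereal_convex[OF conv])
    ultimately show "C \<noteq> {} \<and> bounded C \<and> closed C \<and> convex C" by blast
  next
    fix C D assume "C \<in> ?\<C>" "D \<in> ?\<C>"
    then obtain r r' where C: "C = {x. f x \<le> ereal r}" and D: "D = {x. f x \<le> ereal r'}"
      by auto
    show "C \<subseteq> D \<or> D \<subseteq> C"
    proof (cases "r \<le> r'")
      case True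
      then show ?thesis by (auto simp: C D intro: order_trans)
    next
      case False
      then have "ereal r' \<le> ereal r" by simp
      then show ?thesis by (auto simp: C D intro: order_trans)
    qed
  qed
  then obtain x where x: "\<And>r. (INF x. f x) < ereal r \<Longrightarrow> r \<le> \<gamma> \<Longrightarrow> f x \<le> ereal r"
    by auto
  have "f x \<le> (INF x. f x)"
  proof (rule ccontr)
    assume "\<not> f x \<le> (INF x. f x)"
    then have "(INF x. f x) < min (f x) (ereal \<gamma>)"
      using less by simp
    then obtain r where r: "(INF x. f x) < ereal r" "ereal r < min (f x) (ereal \<gamma>)"
      using ereal_dense2 by blast
    then have "f x \<le> ereal r" by (intro x) auto
    moreover have "ereal r < f x" using r(2) by (simp only: min_less_iff_conj)
    ultimately show False by (meson leD)
  qed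
  moreover have "(INF x. f x) \<le> f x" by (rule INF_lower) simp
  ultimately have "f x = (INF x. f x)" by (rule antisym)
  then show thesis by (rule that)
qed

section \<open>Two affine functions that are never both small\<close>

text \<open>The normal \<open>(u,w)\<close> of a line separating the convex set \<open>{(\<phi>\<^sub>1 x, \<phi>\<^sub>2 x)}\<close> from the quadrant
  \<open>{(p,q). p < \<alpha> \<and> q < \<alpha>}\<close> has nonnegative coordinates, since the quadrant is unbounded in both
  directions; normalising it gives \<open>t\<close>.\<close>

lemma affine_pair_alternative:
  assumes "\<phi>1 \<in> Phi_conv" "\<phi>2 \<in> Phi_conv" and ip: "intersection_property \<phi>1 \<phi>2 \<alpha>"
  obtains t :: real where "0 \<le> t" "t \<le> 1" "\<And>x. \<alpha> \<le> t * \<phi>1 x + (1 - t) * \<phi>2 x"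
proof -
  obtain l1 l2 c1 c2 where \<phi>: "\<phi>1 = (\<lambda>x. blinfun_apply l1 x + c1)"
    "\<phi>2 = (\<lambda>x. blinfun_apply l2 x + c2)"
    using assms(1,2) by (auto simp: Phi_conv_def)
  let ?S = "range (\<lambda>x. (\<phi>1 x, \<phi>2 x))"
  let ?Q = "{..<\<alpha>} \<times> {..<\<alpha>}"
  have "convex ?S"
  proof (rule convexI)
    fix p q and s t :: real
    assume "p \<in> ?S" "q \<in> ?S" and st: "0 \<le> s" "0 \<le> t" "s + t = 1"
    then obtain x y where xy: "p = (\<phi>1 x, \<phi>2 x)" "q = (\<phi>1 y, \<phi>2 y)" by auto
    have c: "s * c + t * c = c" for c
      using st by (simp add: distrib_right[symmetric])
    have "s *\<^sub>R p + t *\<^sub>R q = (\<phi>1 (s *\<^sub>R x + t *\<^sub>R y), \<phi>2 (s *\<^sub>R x + t *\<^sub>R y))"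
      using c[of c1] c[of c2]
      by (simp add: xy \<phi> blinfun.add_right blinfun.scaleR_right algebra_simps)
    then show "s *\<^sub>R p + t *\<^sub>R q \<in> ?S" by blast
  qed
  moreover have "convex ?Q"
    by (intro convex_Times convex_real_interval)
  moreover have "?Q \<noteq> {}"
    using lt_ex[of \<alpha>] by auto
  moreover have "?Q \<inter> ?S = {}"
    using ip by (auto simp: intersection_property_def)
  ultimately obtain n b where n: "n \<noteq> 0" "\<forall>p\<in>?Q. n \<bullet> p \<le> b" "\<forall>p\<in>?S. b \<le> n \<bullet> p"
    using separating_hyperplane_sets[of ?Q ?S] by blast
  obtain u w where uw: "n = (u, w)" by (cases n)
  have Q: "u * p + w * q \<le> b" if "p < \<alpha>" "q < \<alpha>" for p q
    using n(2) that by (force simp: uw)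
  have nonneg: "0 \<le> u" "0 \<le> w"
  proof -
    have no: "0 \<le> k" if "\<And>r. 0 < r \<Longrightarrow> k * (\<alpha> - r) \<le> e" for k e :: real
    proof (rule ccontr)
      assume k: "\<not> 0 \<le> k"
      define r where "r = (\<bar>e - k * \<alpha>\<bar> + 1) / (- k)"
      have r: "0 < r" unfolding r_def using k by (intro divide_pos_pos) auto
      have "k * r = - (\<bar>e - k * \<alpha>\<bar> + 1)" using k by (simp add: r_def field_simps)
      then have "k * (\<alpha> - r) = k * \<alpha> + \<bar>e - k * \<alpha>\<bar> + 1" by (simp add: right_diff_distrib)
      with that[OF r] show False by linarith
    qed
    show "0 \<le> u"
      using Q[of _ "\<alpha> - 1"] by (intro no[of u "b - w * (\<alpha> - 1)"]) (simp add: le_diff_eq)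
    show "0 \<le> w"
      using Q[of "\<alpha> - 1"] by (intro no[of w "b - u * (\<alpha> - 1)"]) (simp add: le_diff_eq add.commute[of "w * _"])
  qed
  have pos: "0 < u + w"
    using nonneg n(1) by (auto simp: uw zero_prod_def add_nonneg_eq_0_iff order_less_le)
  \<comment> \<open>The corner \<open>(\<alpha>,\<alpha>)\<close> is a limit of points of the quadrant.\<close>
  have corner: "(u + w) * \<alpha> \<le> b"
  proof (rule field_le_epsilon)
    fix e :: real assume e: "0 < e"
    have "u * (\<alpha> - e / (u + w)) + w * (\<alpha> - e / (u + w)) \<le> b"
      using e pos by (intro Q) auto
    moreover have "u * (\<alpha> - e / (u + w)) + w * (\<alpha> - e / (u + w)) = (u + w) * (\<alpha> - e / (u + w))"
      by (rule distrib_right[symmetric])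
    moreover have "\<dots> = (u + w) * \<alpha> - e"
      using pos by (simp add: right_diff_distrib)
    ultimately show "(u + w) * \<alpha> \<le> b + e" by linarith
  qed
  have weight: "w / (u + w) = 1 - u / (u + w)"
    using pos by (simp add: field_simps)
  show thesis
  proof (rule that[of "u / (u + w)"])
    show "0 \<le> u / (u + w)" "u / (u + w) \<le> 1"
      using nonneg pos by auto
    fix x
    have "(u + w) * \<alpha> \<le> u * \<phi>1 x + w * \<phi>2 x"
    proof -
      have "b \<le> n \<bullet> (\<phi>1 x, \<phi>2 x)" by (rule n(3)[rule_format, OF rangeI])
      then show ?thesis using corner by (simp add: uw)
    qed
    then have "\<alpha> \<le> (u * \<phi>1 x + w * \<phi>2 x) / (u + w)"
      using pos by (simp add: field_simps)
    also have "\<dots> = u / (u + w) * \<phi>1 x + w / (u + w) * \<phi>2 x"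
      by (simp only: add_divide_distrib times_divide_eq_left)
    also have "\<dots> = u / (u + w) * \<phi>1 x + (1 - u / (u + w)) * \<phi>2 x"
      by (simp only: weight)
    finally show "\<alpha> \<le> u / (u + w) * \<phi>1 x + (1 - u / (u + w)) * \<phi>2 x" .
  qed
qed

section \<open>The minimax equality\<close>

lemma lower_value_ge_of_intersection_property:
  fixes a :: "'a::real_normed_vector \<Rightarrow> 'b::real_vector \<Rightarrow> ereal"
  assumes conc: "\<And>x. ereal_concave (\<lambda>y. a x y)"
    and \<phi>1: "\<phi>1 \<in> Phi_conv" "\<And>x. ereal (\<phi>1 x) \<le> a x y1"
    and \<phi>2: "\<phi>2 \<in> Phi_conv" "\<And>x. ereal (\<phi>2 x) \<le> a x y2"
    and ip: "intersection_property \<phi>1 \<phi>2 \<alpha>"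
  shows "ereal \<alpha> \<le> (SUP y. INF x. a x y)"
proof -
  obtain t where t: "0 \<le> t" "t \<le> 1" and le: "\<And>x. \<alpha> \<le> t * \<phi>1 x + (1 - t) * \<phi>2 x"
    using affine_pair_alternative[OF \<phi>1(1) \<phi>2(1) ip] by blast
  let ?y = "t *\<^sub>R y1 + (1 - t) *\<^sub>R y2"
  have "ereal \<alpha> \<le> a x ?y" for x
  proof -
    have "ereal (t * \<phi>1 x + (1 - t) * \<phi>2 x) \<le> a x ?y"
    proof (cases "t = 0 \<or> t = 1")
      case True
      then show ?thesis using \<phi>1(2)[of x] \<phi>2(2)[of x] by auto
    next
      case False
      then have "0 < t" "t < 1" using t by auto
      then have "ereal t * a x y1 + ereal (1 - t) * a x y2 \<le> a x ?y"
        using conc[of x] by (auto simp: ereal_concave_def)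
      moreover have "ereal t * ereal (\<phi>1 x) + ereal (1 - t) * ereal (\<phi>2 x)
          \<le> ereal t * a x y1 + ereal (1 - t) * a x y2"
        using t \<phi>1(2) \<phi>2(2) by (intro add_mono ereal_mult_left_mono) auto
      ultimately show ?thesis by simp
    qed
    then show ?thesis using le[of x] by (meson ereal_less_eq(3) order_trans)
  qed
  then have "ereal \<alpha> \<le> (INF x. a x ?y)" by (intro INF_greatest)
  also have "\<dots> \<le> (SUP y. INF x. a x y)" by (intro SUP_upper) simp
  finally show ?thesis .
qed

text \<open>Mixing a little of \<open>ytil\<close> into the maximiser \<open>ybar\<close> produces a bounded sublevel set, hence
  a minimiser, while the infimum drops by as little as desired.\<close>

lemma attained_near_maximiser:
  fixes a :: "'a::real_normed_vector \<Rightarrow> 'b::real_vector \<Rightarrow> ereal"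
  assumes refl: "reflexive_space TYPE('a)"
    and nm: "\<And>x y. a x y \<noteq> -\<infinity>"
    and proper: "\<And>y. proper_fun (\<lambda>x. a x y)"
    and cont: "\<And>y. continuous_on UNIV (\<lambda>x. a x y)"
    and conv: "\<And>y. ereal_convex (\<lambda>x. a x y)"
    and conc: "\<And>x. ereal_concave (\<lambda>y. a x y)"
    and ybar: "(SUP y. INF x. a x y) = (INF x. a x ybar)"
    and \<gamma>: "(SUP y. INF x. a x y) < ereal \<gamma>" "bounded {x. a x ytil \<le> ereal \<gamma>}"
    and \<alpha>: "ereal \<alpha> < (SUP y. INF x. a x y)"
  obtains y x0 where "a x0 y = (INF x. a x y)" "ereal \<alpha> \<le> a x0 y" "a x0 y < \<infinity>"
proof -
  have inf_le: "(INF x. a x y) \<le> (SUP y. INF x. a x y)" for y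
    by (intro SUP_upper) simp
  obtain v where v: "(SUP y. INF x. a x y) = ereal v"
    using \<gamma>(1) \<alpha> by (cases "SUP y. INF x. a x y") auto
  have \<alpha>v: "\<alpha> < v" and v\<gamma>: "v < \<gamma>" using \<alpha> \<gamma>(1) v by auto
  have bar_ge: "ereal v \<le> a x ybar" for x
    using ybar v by (metis INF_lower UNIV_I)
  obtain xt where xt: "a xt ytil = (INF x. a x ytil)"
    using reflexive_attains_inf[OF refl cont conv \<gamma>(2)] inf_le[of ytil] \<gamma>(1)
    by (metis order_le_less_trans)
  obtain m where m: "(INF x. a x ytil) = ereal m" "m \<le> v"
    using xt nm[of xt ytil] inf_le[of ytil] v by (cases "INF x. a x ytil") auto
  have til_ge: "ereal m \<le> a x ytil" for x
    using m(1) by (metis INF_lower UNIV_I)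
  \<comment> \<open>The weight of \<open>ytil\<close>, small enough that \<open>s(v - m) \<le> v - \<alpha>\<close>; the summand \<open>1\<close> covers \<open>v = m\<close>.\<close>
  define s where "s = min (1 / 2) ((v - \<alpha>) / (v - m + 1))"
  have s: "0 < s" "s < 1" using \<alpha>v m(2) by (auto simp: s_def)
  have s_small: "s * (v - m) \<le> v - \<alpha>"
  proof -
    have "s * (v - m) \<le> (v - \<alpha>) / (v - m + 1) * (v - m + 1)"
      using m(2) \<alpha>v s by (intro mult_mono) (auto simp: s_def)
    also have "\<dots> = v - \<alpha>" using m(2) by simp
    finally show ?thesis .
  qed
  define y where "y = (1 - s) *\<^sub>R ybar + s *\<^sub>R ytil"
  have y_ge: "ereal ((1 - s) * v) + ereal s * a x ytil \<le> a x y" for x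
  proof -
    have "ereal (1 - s) * a x ybar + ereal (1 - (1 - s)) * a x ytil
        \<le> a x ((1 - s) *\<^sub>R ybar + (1 - (1 - s)) *\<^sub>R ytil)"
      using conc[of x, unfolded ereal_concave_def, rule_format, of "1 - s" ybar ytil] s by simp
    then have "ereal (1 - s) * a x ybar + ereal s * a x ytil \<le> a x y"
      by (simp add: y_def)
    moreover have "ereal (1 - s) * ereal v \<le> ereal (1 - s) * a x ybar"
      using bar_ge s by (intro ereal_mult_left_mono) auto
    ultimately show ?thesis
      by (metis add_right_mono order_trans times_ereal.simps(1))
  qed
  have ge_\<alpha>: "ereal \<alpha> \<le> a x y" for x
  proof -
    have "\<alpha> \<le> (1 - s) * v + s * m" using s_small by (simp add: algebra_simps)
    then have "ereal \<alpha> \<le> ereal ((1 - s) * v) + ereal s * ereal m" by simp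
    also have "\<dots> \<le> ereal ((1 - s) * v) + ereal s * a x ytil"
      using til_ge s by (intro add_left_mono ereal_mult_left_mono) auto
    also note y_ge
    finally show ?thesis .
  qed
  let ?\<beta> = "(1 - s) * v + s * \<gamma>"
  have sub: "{x. a x y \<le> ereal ?\<beta>} \<subseteq> {x. a x ytil \<le> ereal \<gamma>}"
  proof safe
    fix x assume "a x y \<le> ereal ?\<beta>"
    with y_ge[of x] have le: "ereal ((1 - s) * v) + ereal s * a x ytil \<le> ereal ?\<beta>"
      by (rule order_trans)
    show "a x ytil \<le> ereal \<gamma>"
      using le s nm[of x ytil] by (cases "a x ytil") auto
  qed
  have "s * v < s * \<gamma>" using s v\<gamma> by simp
  then have "v < ?\<beta>" by (simp add: algebra_simps)
  then have "(INF x. a x y) < ereal ?\<beta>"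
    using inf_le[of y] v by (simp add: order_le_less_trans)
  then obtain x0 where x0: "a x0 y = (INF x. a x y)"
    using reflexive_attains_inf[OF refl cont conv bounded_subset[OF \<gamma>(2) sub]] by metis
  have "a x0 y \<le> ereal v"
    using inf_le[of y] by (simp only: x0 v)
  then have "a x0 y < \<infinity>"
    by (rule order_le_less_trans) simp
  then show thesis by (rule that[OF x0 ge_\<alpha>])
qed

lemma const_mem_subdiff_conv:
  fixes f :: "'v::real_normed_vector \<Rightarrow> ereal"
  assumes min: "f x0 = (INF x. f x)" and w: "f x0 = ereal w"
  shows "(\<lambda>_. w) \<in> subdiff_conv f x0"
proof -
  have "(\<lambda>_ :: 'v. w) \<in> Phi_conv"
    unfolding Phi_conv_def by (rule CollectI, rule exI[of _ 0], rule exI[of _ w]) simp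
  moreover have "ereal w \<le> f x" for x
    unfolding w[symmetric] min by (rule INF_lower) simp
  ultimately show ?thesis using w by (simp add: subdiff_conv_def)
qed

theorem theorem6p4:
  fixes a :: "'a::banach \<Rightarrow> 'b::real_vector \<Rightarrow> ereal"
  assumes "reflexive_space TYPE('a)"
    and "\<And>x y. a x y \<noteq> -\<infinity>"
    and "\<And>y. proper_fun (\<lambda>x. a x y)"
    and "\<And>y. continuous_on UNIV (\<lambda>x. a x y)"
    and "\<And>y. ereal_convex (\<lambda>x. a x y)"
    and "\<And>x. ereal_concave (\<lambda>y. a x y)"
    and "\<exists>ybar. (SUP y. INF x. a x y) = (INF x. a x ybar)"
    and "\<exists>(ytil :: 'b) (\<gamma> :: real).
           ereal \<gamma> > (SUP y. INF x. a x y) \<and> bounded {x. a x ytil \<le> ereal \<gamma>}"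
  shows "(\<forall>\<alpha>::real. ereal \<alpha> < (INF x. SUP y. a x y) \<longrightarrow>
            (\<exists>y1 y2. \<exists>x1 \<in> eff_dom (\<lambda>x. a x y1). \<exists>x2 \<in> eff_dom (\<lambda>x. a x y2).
               \<exists>\<phi>1 \<in> subdiff_conv (\<lambda>x. a x y1) x1. \<exists>\<phi>2 \<in> subdiff_conv (\<lambda>x. a x y2) x2.
                 intersection_property \<phi>1 \<phi>2 \<alpha>))
         \<longleftrightarrow> (SUP y. INF x. a x y) = (INF x. SUP y. a x y)"
proof
  let ?low = "SUP y. INF x. a x y" and ?up = "INF x. SUP y. a x y"
  assume i: "\<forall>\<alpha>::real. ereal \<alpha> < ?up \<longrightarrow>
            (\<exists>y1 y2. \<exists>x1 \<in> eff_dom (\<lambda>x. a x y1). \<exists>x2 \<in> eff_dom (\<lambda>x. a x y2).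
               \<exists>\<phi>1 \<in> subdiff_conv (\<lambda>x. a x y1) x1. \<exists>\<phi>2 \<in> subdiff_conv (\<lambda>x. a x y2) x2.
                 intersection_property \<phi>1 \<phi>2 \<alpha>)"
  have ge: "ereal \<alpha> \<le> ?low" if \<alpha>: "ereal \<alpha> < ?up" for \<alpha>
  proof -
    obtain y1 y2 x1 x2 \<phi>1 \<phi>2 where "\<phi>1 \<in> subdiff_conv (\<lambda>x. a x y1) x1"
      "\<phi>2 \<in> subdiff_conv (\<lambda>x. a x y2) x2" "intersection_property \<phi>1 \<phi>2 \<alpha>"
      using i \<alpha> by blast
    then show ?thesis
      by (intro lower_value_ge_of_intersection_property[OF assms(6)])
        (auto simp: subdiff_conv_def)
  qed
  have "?up \<le> ?low"
  proof (rule ccontr)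
    assume "\<not> ?up \<le> ?low"
    then have "?low < ?up" by (simp only: not_le)
    then obtain \<alpha> where "?low < ereal \<alpha>" "ereal \<alpha> < ?up"
      using ereal_dense2 by blast
    with ge[of \<alpha>] show False by (meson leD)
  qed
  moreover have "?low \<le> ?up"
  proof (intro SUP_least INF_greatest)
    fix y x
    have "(INF x. a x y) \<le> a x y" by (rule INF_lower) simp
    also have "\<dots> \<le> (SUP y. a x y)" by (rule SUP_upper) simp
    finally show "(INF x. a x y) \<le> (SUP y. a x y)" .
  qed
  ultimately show "?low = ?up" by (rule antisym[rotated])
next
  let ?low = "SUP y. INF x. a x y" and ?up = "INF x. SUP y. a x y"
  assume eq: "?low = ?up"
  obtain ybar where ybar: "?low = (INF x. a x ybar)" using assms(7) by blast
  obtain ytil \<gamma> where \<gamma>: "?low < ereal \<gamma>" "bounded {x. a x ytil \<le> ereal \<gamma>}"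
    using assms(8) by blast
  show "\<forall>\<alpha>::real. ereal \<alpha> < ?up \<longrightarrow>
            (\<exists>y1 y2. \<exists>x1 \<in> eff_dom (\<lambda>x. a x y1). \<exists>x2 \<in> eff_dom (\<lambda>x. a x y2).
               \<exists>\<phi>1 \<in> subdiff_conv (\<lambda>x. a x y1) x1. \<exists>\<phi>2 \<in> subdiff_conv (\<lambda>x. a x y2) x2.
                 intersection_property \<phi>1 \<phi>2 \<alpha>)"
  proof (intro allI impI)
    fix \<alpha> :: real assume "ereal \<alpha> < ?up"
    then have \<alpha>: "ereal \<alpha> < ?low" by (simp only: eq)
    obtain y x0 where x0: "a x0 y = (INF x. a x y)" "ereal \<alpha> \<le> a x0 y" "a x0 y < \<infinity>"
      by (rule attained_near_maximiser[OF assms(1-6) ybar \<gamma> \<alpha>])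
    obtain w where w: "a x0 y = ereal w" "\<alpha> \<le> w"
      using x0(2,3) by (cases "a x0 y") auto
    have "(\<lambda>_. w) \<in> subdiff_conv (\<lambda>x. a x y) x0"
      using x0(1) w(1) by (rule const_mem_subdiff_conv)
    moreover have "x0 \<in> eff_dom (\<lambda>x. a x y)"
      using x0(3) by (simp add: eff_dom_def)
    moreover have "intersection_property (\<lambda>_ :: 'a. w) (\<lambda>_. w) \<alpha>"
      using w(2) by (simp add: intersection_property_def)
    ultimately show "\<exists>y1 y2. \<exists>x1 \<in> eff_dom (\<lambda>x. a x y1). \<exists>x2 \<in> eff_dom (\<lambda>x. a x y2).
               \<exists>\<phi>1 \<in> subdiff_conv (\<lambda>x. a x y1) x1. \<exists>\<phi>2 \<in> subdiff_conv (\<lambda>x. a x y2) x2.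
                 intersection_property \<phi>1 \<phi>2 \<alpha>"
      by blast
  qed
qed

end
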